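(* Let $\Omega$ be a commutative semigroup, let $(V;\rho,\theta)$ be a representation of a Lie-Yamaguti algebra $(L,[\cdot,\cdot],\{\cdot,\cdot,\cdot\})$, let $\Gamma=(\Gamma_1,\Gamma_2)$ be a $(2,3)$-cocycle of $L$ with coefficients in $V$, and let $\{T_\alpha:V\to L\}_{\alpha\in\Omega}$ be a $\Gamma$-twisted Rota-Baxter family. Then $(V,\{[\cdot,\cdot]_{\alpha,\beta},\{\cdot,\cdot,\cdot\}_{\alpha,\beta,\gamma}\}_{\alpha,\beta,\gamma\in\Omega})$ is an $\Omega$-Lie-Yamaguti algebra, where $$[u,v]_{\alpha,\beta}=\rho(T_\alpha u)v-\rho(T_\beta v)u+\Gamma_1(T_\alpha u,T_\beta v),$$ $$\{u,v,w\}_{\alpha,\beta,\gamma}=D(T_\alpha u,T_\beta v)w+\theta(T_\beta v,T_\gamma w)u-\theta(T_\alpha u,T_\gamma w)v+\Gamma_2(T_\alpha u,T_\beta v,T_\gamma w)$$ for all $u,v,w\in V$ and $\alpha,\beta,\gamma\in\Omega$.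
   Context: All vector spaces are over an algebraically closed field $\mathbb K$ of characteristic different from $2$ and $3$. **Lie-Yamaguti algebra.** A vector space $L$ with a bilinear bracket $[\cdot,\cdot]:\wedge^2L\to L$ and a trilinear bracket $\{\cdot,\cdot,\cdot\}:\wedge^2L\otimes L\to L$ (skew-symmetric in the first two arguments) such that for all $x,y,z,a,b\in L$: (1) $[[x,y],z]+[[y,z],x]+[[z,x],y]+\{x,y,z\}+\{z,x,y\}+\{y,z,x\}=0$; (2) $\{[x,y],z,a\}+\{[y,z],x,a\}+\{[z,x],y,a\}=0$; (3) $\{a,b,[x,y]\}=[\{a,b,x\},y]+[x,\{a,b,y\}]$; (4) $\{a,b,\{x,y,z\}\}=\{\{a,b,x\},y,z\}+\{x,\{a,b,y\},z\}+\{x,y,\{a,b,z\}\}$. **Representation.** A representation of $L$ on a vector space $V$ is a linear map $\rho:L\to\mathrm{End}(V)$ and a bilinear map $\theta:L\times L\to\mathrm{End}(V)$ such that, with $D(x,y)=\theta(y,x)-\theta(x,y)-\rho([x,y])+\rho(x)\rho(y)-\rho(y)\rho(x)$, for all $x,y,z,a,b\in L$: $\theta([x,y],z)-\theta(x,z)\rho(y)+\theta(y,z)\rho(x)=0$; $D(x,y)\rho(z)-\rho(z)D(x,y)-\rho(\{x,y,z\})=0$; $\theta(x,[y,z])-\rho(y)\theta(x,z)+\rho(z)\theta(x,y)=0$; $D(a,b)\theta(x,y)-\theta(x,y)D(a,b)-\theta(\{a,b,x\},y)-\theta(x,\{a,b,y\})=0$; $\theta(a,\{x,y,z\})-\theta(y,z)\theta(a,x)+\theta(x,z)\theta(a,y)-D(x,y)\theta(a,z)=0$.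 **$(2,3)$-cocycle.** A pair $\Gamma=(\Gamma_1,\Gamma_2)\in\mathrm{Hom}(\wedge^2L,V)\times\mathrm{Hom}(\wedge^2L\otimes L,V)$ such that for all $x_1,y_1,x_2,y_2,z\in L$: $-\rho(x_1)\Gamma_1(y_1,z)-\rho(y_1)\Gamma_1(z,x_1)-\rho(z)\Gamma_1(x_1,y_1)+\Gamma_1([x_1,y_1],z)+\Gamma_1([y_1,z],x_1)+\Gamma_1([z,x_1],y_1)+\Gamma_2(x_1,y_1,z)+\Gamma_2(y_1,z,x_1)+\Gamma_2(z,x_1,y_1)=0$; $\theta(x_1,y_2)\Gamma_1(y_1,x_2)+\theta(y_1,y_2)\Gamma_1(x_2,x_1)+\theta(x_2,y_2)\Gamma_1(x_1,y_1)+\Gamma_2([x_1,y_1],x_2,y_2)+\Gamma_2([y_1,x_2],x_1,y_2)+\Gamma_2([x_2,x_1],y_1,y_2)=0$; $-\rho(x_2)\Gamma_2(x_1,y_1,y_2)+\rho(y_2)\Gamma_2(x_1,y_1,x_2)+\Gamma_2(x_1,y_1,[x_2,y_2])+D(x_1,y_1)\Gamma_1(x_2,y_2)-\Gamma_1(\{x_1,y_1,x_2\},y_2)-\Gamma_1(x_2,\{x_1,y_1,y_2\})=0$; $-\theta(y_2,z)\Gamma_2(x_1,y_1,x_2)+\theta(x_2,z)\Gamma_2(x_1,y_1,y_2)+D(x_1,y_1)\Gamma_2(x_2,y_2,z)-D(x_2,y_2)\Gamma_2(x_1,y_1,z)-\Gamma_2(\{x_1,y_1,x_2\},y_2,z)-\Gamma_2(x_2,\{x_1,y_1,y_2\},z)+\Gamma_2(x_1,y_1,\{x_2,y_2,z\})-\Gamma_2(x_2,y_2,\{x_1,y_1,z\})=0$.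 **$\Gamma$-twisted Rota-Baxter family.** A collection of linear maps $\{T_\alpha:V\to L\}_{\alpha\in\Omega}$ such that for all $u,v,w\in V$, $\alpha,\beta,\gamma\in\Omega$: $[T_\alpha u,T_\beta v]=T_{\alpha\beta}\big(\rho(T_\alpha u)v-\rho(T_\beta v)u+\Gamma_1(T_\alpha u,T_\beta v)\big)$; $\{T_\alpha u,T_\beta v,T_\gamma w\}=T_{\alpha\beta\gamma}\big(D(T_\alpha u,T_\beta v)w-\theta(T_\alpha u,T_\gamma w)v+\theta(T_\beta v,T_\gamma w)u+\Gamma_2(T_\alpha u,T_\beta v,T_\gamma w)\big)$. **$\Omega$-Lie-Yamaguti algebra.** A vector space $A$ with bilinear operations $[\cdot,\cdot]_{\alpha,\beta}$ and trilinear operations $\{\cdot,\cdot,\cdot\}_{\alpha,\beta,\gamma}$ ($\alpha,\beta,\gamma\in\Omega$) such that for all $x,y,z,a,b\in A$ and $\alpha,\beta,\gamma,\varsigma,\tau\in\Omega$: $[x,y]_{\alpha,\beta}=-[y,x]_{\beta,\alpha}$, $\{x,y,z\}_{\alpha,\beta,\gamma}=-\{y,x,z\}_{\beta,\alpha,\gamma}$; $[[x,y]_{\alpha,\beta},z]_{\alpha\beta,\gamma}+[[y,z]_{\beta,\gamma},x]_{\beta\gamma,\alpha}+[[z,x]_{\gamma,\alpha},y]_{\gamma\alpha,\beta}+\{x,y,z\}_{\alpha,\beta,\gamma}+\{y,z,x\}_{\beta,\gamma,\alpha}+\{z,x,y\}_{\gamma,\alpha,\beta}=0$; $\{[x,y]_{\alpha,\beta},z,a\}_{\alpha\beta,\gamma,\varsigma}+\{[y,z]_{\beta,\gamma},x,a\}_{\beta\gamma,\alpha,\varsigma}+\{[z,x]_{\gamma,\alpha},y,a\}_{\gamma\alpha,\beta,\varsigma}=0$;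 $\{a,x,[y,z]_{\beta,\gamma}\}_{\varsigma,\alpha,\beta\gamma}=[\{a,x,y\}_{\varsigma,\alpha,\beta},z]_{\varsigma\alpha\beta,\gamma}+[y,\{a,x,z\}_{\varsigma,\alpha,\gamma}]_{\beta,\varsigma\alpha\gamma}$; $\{a,b,\{x,y,z\}_{\alpha,\beta,\gamma}\}_{\varsigma,\tau,\alpha\beta\gamma}=\{\{a,b,x\}_{\varsigma,\tau,\alpha},y,z\}_{\varsigma\tau\alpha,\beta,\gamma}+\{x,\{a,b,y\}_{\varsigma,\tau,\beta},z\}_{\alpha,\varsigma\tau\beta,\gamma}+\{x,y,\{a,b,z\}_{\varsigma,\tau,\gamma}\}_{\alpha,\beta,\varsigma\tau\gamma}$. *)

theory Defs
  imports "HOL-Computational_Algebra.Polynomial"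
begin

definition bilinear_map ::
  "('k::field \<Rightarrow> 'a::ab_group_add \<Rightarrow> 'a) \<Rightarrow> ('k \<Rightarrow> 'b::ab_group_add \<Rightarrow> 'b) \<Rightarrow>
   ('k \<Rightarrow> 'c::ab_group_add \<Rightarrow> 'c) \<Rightarrow> ('a \<Rightarrow> 'b \<Rightarrow> 'c) \<Rightarrow> bool"
  where "bilinear_map s1 s2 s3 f \<longleftrightarrow>
    (\<forall>x. Vector_Spaces.linear s2 s3 (f x)) \<and>
    (\<forall>y. Vector_Spaces.linear s1 s3 (\<lambda>x. f x y))"

definition trilinear_map ::
  "('k::field \<Rightarrow> 'a::ab_group_add \<Rightarrow> 'a) \<Rightarrow> ('k \<Rightarrow> 'b::ab_group_add \<Rightarrow> 'b) \<Rightarrow>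
   ('k \<Rightarrow> 'c::ab_group_add \<Rightarrow> 'c) \<Rightarrow> ('k \<Rightarrow> 'd::ab_group_add \<Rightarrow> 'd) \<Rightarrow>
   ('a \<Rightarrow> 'b \<Rightarrow> 'c \<Rightarrow> 'd) \<Rightarrow> bool"
  where "trilinear_map s1 s2 s3 s4 f \<longleftrightarrow>
    (\<forall>x y. Vector_Spaces.linear s3 s4 (f x y)) \<and>
    (\<forall>x z. Vector_Spaces.linear s2 s4 (\<lambda>y. f x y z)) \<and>
    (\<forall>y z. Vector_Spaces.linear s1 s4 (\<lambda>x. f x y z))"

text \<open>
  Maps out of an exterior square are encoded as multilinear maps that are skew-symmetric in the
  first two arguments. This agrees with the alternating condition because the characteristic
  of the ground field is not 2 wherever these notions are used.
\<close>

locale lie_yamaguti_algebra = vector_space sL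
  for sL :: "'k::field \<Rightarrow> 'l::ab_group_add \<Rightarrow> 'l" +
  fixes br :: "'l \<Rightarrow> 'l \<Rightarrow> 'l"
    and tr :: "'l \<Rightarrow> 'l \<Rightarrow> 'l \<Rightarrow> 'l"
  assumes br_bilinear: "bilinear_map sL sL sL br"
    and tr_trilinear: "trilinear_map sL sL sL sL tr"
    and br_skew: "br x y = - br y x"
    and tr_skew: "tr x y z = - tr y x z"
    and LY1: "br (br x y) z + br (br y z) x + br (br z x) y
              + tr x y z + tr z x y + tr y z x = 0"
    and LY2: "tr (br x y) z a + tr (br y z) x a + tr (br z x) y a = 0"
    and LY3: "tr a b (br x y) = br (tr a b x) y + br x (tr a b y)"
    and LY4: "tr a b (tr x y z) = tr (tr a b x) y z + tr x (tr a b y) z + tr x y (tr a b z)"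

definition rep_D ::
  "('l \<Rightarrow> 'l \<Rightarrow> 'l) \<Rightarrow> ('l \<Rightarrow> 'v::ab_group_add \<Rightarrow> 'v) \<Rightarrow> ('l \<Rightarrow> 'l \<Rightarrow> 'v \<Rightarrow> 'v) \<Rightarrow>
   'l \<Rightarrow> 'l \<Rightarrow> 'v \<Rightarrow> 'v"
  where "rep_D br \<rho> \<theta> x y v =
    \<theta> y x v - \<theta> x y v - \<rho> (br x y) v + \<rho> x (\<rho> y v) - \<rho> y (\<rho> x v)"

text \<open>
  Linear maps into \<open>End(V)\<close> are given in uncurried form, so that multilinearity of \<open>\<rho>\<close> and \<open>\<theta>\<close>
  also says that each operator \<open>\<rho> x\<close> and \<open>\<theta> x y\<close> is linear on \<open>V\<close>; operator identities are
  stated pointwise.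
\<close>

locale ly_representation = lie_yamaguti_algebra sL br tr + V: vector_space sV
  for sL :: "'k::field \<Rightarrow> 'l::ab_group_add \<Rightarrow> 'l"
    and br :: "'l \<Rightarrow> 'l \<Rightarrow> 'l"
    and tr :: "'l \<Rightarrow> 'l \<Rightarrow> 'l \<Rightarrow> 'l"
    and sV :: "'k \<Rightarrow> 'v::ab_group_add \<Rightarrow> 'v" +
  fixes \<rho> :: "'l \<Rightarrow> 'v \<Rightarrow> 'v"
    and \<theta> :: "'l \<Rightarrow> 'l \<Rightarrow> 'v \<Rightarrow> 'v"
  assumes \<rho>_linear: "bilinear_map sL sV sV \<rho>"
    and \<theta>_bilinear: "trilinear_map sL sL sV sV \<theta>"
    and rep1: "\<theta> (br x y) z v - \<theta> x z (\<rho> y v) + \<theta> y z (\<rho> x v) = 0"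
    and rep2: "rep_D br \<rho> \<theta> x y (\<rho> z v) - \<rho> z (rep_D br \<rho> \<theta> x y v) - \<rho> (tr x y z) v = 0"
    and rep3: "\<theta> x (br y z) v - \<rho> y (\<theta> x z v) + \<rho> z (\<theta> x y v) = 0"
    and rep4: "rep_D br \<rho> \<theta> a b (\<theta> x y v) - \<theta> x y (rep_D br \<rho> \<theta> a b v)
               - \<theta> (tr a b x) y v - \<theta> x (tr a b y) v = 0"
    and rep5: "\<theta> a (tr x y z) v - \<theta> y z (\<theta> a x v) + \<theta> x z (\<theta> a y v)
               - rep_D br \<rho> \<theta> x y (\<theta> a z v) = 0"

locale ly_cocycle = ly_representation sL br tr sV \<rho> \<theta>
  for sL :: "'k::field \<Rightarrow> 'l::ab_group_add \<Rightarrow> 'l"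
    and br :: "'l \<Rightarrow> 'l \<Rightarrow> 'l"
    and tr :: "'l \<Rightarrow> 'l \<Rightarrow> 'l \<Rightarrow> 'l"
    and sV :: "'k \<Rightarrow> 'v::ab_group_add \<Rightarrow> 'v"
    and \<rho> :: "'l \<Rightarrow> 'v \<Rightarrow> 'v"
    and \<theta> :: "'l \<Rightarrow> 'l \<Rightarrow> 'v \<Rightarrow> 'v" +
  fixes \<Gamma>1 :: "'l \<Rightarrow> 'l \<Rightarrow> 'v"
    and \<Gamma>2 :: "'l \<Rightarrow> 'l \<Rightarrow> 'l \<Rightarrow> 'v"
  assumes \<Gamma>1_bilinear: "bilinear_map sL sL sV \<Gamma>1"
    and \<Gamma>1_skew: "\<Gamma>1 x y = - \<Gamma>1 y x"
    and \<Gamma>2_trilinear: "trilinear_map sL sL sL sV \<Gamma>2"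
    and \<Gamma>2_skew: "\<Gamma>2 x y z = - \<Gamma>2 y x z"
    and cocycle1:
      "- \<rho> x1 (\<Gamma>1 y1 z) - \<rho> y1 (\<Gamma>1 z x1) - \<rho> z (\<Gamma>1 x1 y1)
       + \<Gamma>1 (br x1 y1) z + \<Gamma>1 (br y1 z) x1 + \<Gamma>1 (br z x1) y1
       + \<Gamma>2 x1 y1 z + \<Gamma>2 y1 z x1 + \<Gamma>2 z x1 y1 = 0"
    and cocycle2:
      "\<theta> x1 y2 (\<Gamma>1 y1 x2) + \<theta> y1 y2 (\<Gamma>1 x2 x1) + \<theta> x2 y2 (\<Gamma>1 x1 y1)
       + \<Gamma>2 (br x1 y1) x2 y2 + \<Gamma>2 (br y1 x2) x1 y2 + \<Gamma>2 (br x2 x1) y1 y2 = 0"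
    and cocycle3:
      "- \<rho> x2 (\<Gamma>2 x1 y1 y2) + \<rho> y2 (\<Gamma>2 x1 y1 x2) + \<Gamma>2 x1 y1 (br x2 y2)
       + rep_D br \<rho> \<theta> x1 y1 (\<Gamma>1 x2 y2)
       - \<Gamma>1 (tr x1 y1 x2) y2 - \<Gamma>1 x2 (tr x1 y1 y2) = 0"
    and cocycle4:
      "- \<theta> y2 z (\<Gamma>2 x1 y1 x2) + \<theta> x2 z (\<Gamma>2 x1 y1 y2)
       + rep_D br \<rho> \<theta> x1 y1 (\<Gamma>2 x2 y2 z) - rep_D br \<rho> \<theta> x2 y2 (\<Gamma>2 x1 y1 z)
       - \<Gamma>2 (tr x1 y1 x2) y2 z - \<Gamma>2 x2 (tr x1 y1 y2) z
       + \<Gamma>2 x1 y1 (tr x2 y2 z) - \<Gamma>2 x2 y2 (tr x1 y1 z) = 0"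

locale twisted_rota_baxter_family = ly_cocycle sL br tr sV \<rho> \<theta> \<Gamma>1 \<Gamma>2
  for sL :: "'k::field \<Rightarrow> 'l::ab_group_add \<Rightarrow> 'l"
    and br :: "'l \<Rightarrow> 'l \<Rightarrow> 'l"
    and tr :: "'l \<Rightarrow> 'l \<Rightarrow> 'l \<Rightarrow> 'l"
    and sV :: "'k \<Rightarrow> 'v::ab_group_add \<Rightarrow> 'v"
    and \<rho> :: "'l \<Rightarrow> 'v \<Rightarrow> 'v"
    and \<theta> :: "'l \<Rightarrow> 'l \<Rightarrow> 'v \<Rightarrow> 'v"
    and \<Gamma>1 :: "'l \<Rightarrow> 'l \<Rightarrow> 'v"
    and \<Gamma>2 :: "'l \<Rightarrow> 'l \<Rightarrow> 'l \<Rightarrow> 'v" +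
  fixes T :: "'o::ab_semigroup_mult \<Rightarrow> 'v \<Rightarrow> 'l"
  assumes T_linear: "Vector_Spaces.linear sV sL (T \<alpha>)"
    and T_br:
      "br (T \<alpha> u) (T \<beta> v) =
       T (\<alpha> * \<beta>) (\<rho> (T \<alpha> u) v - \<rho> (T \<beta> v) u + \<Gamma>1 (T \<alpha> u) (T \<beta> v))"
    and T_tr:
      "tr (T \<alpha> u) (T \<beta> v) (T \<gamma> w) =
       T (\<alpha> * \<beta> * \<gamma>)
         (rep_D br \<rho> \<theta> (T \<alpha> u) (T \<beta> v) w - \<theta> (T \<alpha> u) (T \<gamma> w) v + \<theta> (T \<beta> v) (T \<gamma> w) u
          + \<Gamma>2 (T \<alpha> u) (T \<beta> v) (T \<gamma> w))"

locale omega_lie_yamaguti_algebra = vector_space sA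
  for sA :: "'k::field \<Rightarrow> 'a::ab_group_add \<Rightarrow> 'a" +
  fixes br :: "'o::ab_semigroup_mult \<Rightarrow> 'o \<Rightarrow> 'a \<Rightarrow> 'a \<Rightarrow> 'a"
    and tr :: "'o \<Rightarrow> 'o \<Rightarrow> 'o \<Rightarrow> 'a \<Rightarrow> 'a \<Rightarrow> 'a \<Rightarrow> 'a"
  assumes br_bilinear: "bilinear_map sA sA sA (br \<alpha> \<beta>)"
    and tr_trilinear: "trilinear_map sA sA sA sA (tr \<alpha> \<beta> \<gamma>)"
    and br_skew: "br \<alpha> \<beta> x y = - br \<beta> \<alpha> y x"
    and tr_skew: "tr \<alpha> \<beta> \<gamma> x y z = - tr \<beta> \<alpha> \<gamma> y x z"
    and OLY1:
      "br (\<alpha> * \<beta>) \<gamma> (br \<alpha> \<beta> x y) z + br (\<beta> * \<gamma>) \<alpha> (br \<beta> \<gamma> y z) x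
       + br (\<gamma> * \<alpha>) \<beta> (br \<gamma> \<alpha> z x) y
       + tr \<alpha> \<beta> \<gamma> x y z + tr \<beta> \<gamma> \<alpha> y z x + tr \<gamma> \<alpha> \<beta> z x y = 0"
    and OLY2:
      "tr (\<alpha> * \<beta>) \<gamma> \<sigma> (br \<alpha> \<beta> x y) z a + tr (\<beta> * \<gamma>) \<alpha> \<sigma> (br \<beta> \<gamma> y z) x a
       + tr (\<gamma> * \<alpha>) \<beta> \<sigma> (br \<gamma> \<alpha> z x) y a = 0"
    and OLY3:
      "tr \<sigma> \<alpha> (\<beta> * \<gamma>) a x (br \<beta> \<gamma> y z) =
       br (\<sigma> * \<alpha> * \<beta>) \<gamma> (tr \<sigma> \<alpha> \<beta> a x y) z + br \<beta> (\<sigma> * \<alpha> * \<gamma>) y (tr \<sigma> \<alpha> \<gamma> a x z)"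
    and OLY4:
      "tr \<sigma> \<tau> (\<alpha> * \<beta> * \<gamma>) a b (tr \<alpha> \<beta> \<gamma> x y z) =
       tr (\<sigma> * \<tau> * \<alpha>) \<beta> \<gamma> (tr \<sigma> \<tau> \<alpha> a b x) y z
       + tr \<alpha> (\<sigma> * \<tau> * \<beta>) \<gamma> x (tr \<sigma> \<tau> \<beta> a b y) z
       + tr \<alpha> \<beta> (\<sigma> * \<tau> * \<gamma>) x y (tr \<sigma> \<tau> \<gamma> a b z)"

end

(*
  The cocycle Gamma makes L x V a Lie-Yamaguti algebra (a twisted semidirect product): its
  L-component is L itself, and its V-component splits into terms linear in the V-entries, which
  vanish by the representation axioms, and terms involving Gamma, which vanish by the cocycle
  equations. A twisted Rota-Baxter family says exactly that the graph embeddings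
  g_alpha u = (T_alpha u, u) intertwine the Omega-indexed operations on V with those of L x V.
  The Omega-identities are therefore the V-components of the ordinary ones.
*)
theory Submission
  imports Defs "HOL-Analysis.Product_Vector"
begin

section \<open>Multilinear maps as systems of equations\<close>

lemma bilinear_map_iff:
  assumes "vector_space s1" "vector_space s2" "vector_space s3"
  shows "bilinear_map s1 s2 s3 f \<longleftrightarrow>
    (\<forall>x y y'. f x (y + y') = f x y + f x y') \<and> (\<forall>c x y. f x (s2 c y) = s3 c (f x y)) \<and>
    (\<forall>x x' y. f (x + x') y = f x y + f x' y) \<and> (\<forall>c x y. f (s1 c x) y = s3 c (f x y))"
  using assms by (auto simp: bilinear_map_def Vector_Spaces.linear_iff)

lemma trilinear_map_iff:
  assumes "vector_space s1" "vector_space s2" "vector_space s3" "vector_space s4"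
  shows "trilinear_map s1 s2 s3 s4 f \<longleftrightarrow>
    (\<forall>x y z z'. f x y (z + z') = f x y z + f x y z') \<and>
    (\<forall>c x y z. f x y (s3 c z) = s4 c (f x y z)) \<and>
    (\<forall>x y y' z. f x (y + y') z = f x y z + f x y' z) \<and>
    (\<forall>c x y z. f x (s2 c y) z = s4 c (f x y z)) \<and>
    (\<forall>x x' y z. f (x + x') y z = f x y z + f x' y z) \<and>
    (\<forall>c x y z. f (s1 c x) y z = s4 c (f x y z))"
  using assms by (auto simp: trilinear_map_def Vector_Spaces.linear_iff)

section \<open>Operator identities in a representation\<close>

context ly_representation
begin

sublocale prod: vector_space_prod sL sV
  by unfold_locales

abbreviation D where "D \<equiv> rep_D br \<rho> \<theta>"

text \<open>Discharging the vector space conditions leaves plain equations, which serve as rewrite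
  rules from here on.\<close>

lemmas br_linear =
  br_bilinear[unfolded bilinear_map_iff[OF vector_space_axioms vector_space_axioms vector_space_axioms],
    rule_format]

lemmas tr_linear =
  tr_trilinear[unfolded trilinear_map_iff[OF vector_space_axioms vector_space_axioms
    vector_space_axioms vector_space_axioms], rule_format]

lemmas rho_linear =
  \<rho>_linear[unfolded bilinear_map_iff[OF vector_space_axioms V.vector_space_axioms
    V.vector_space_axioms], rule_format]

lemmas theta_linear =
  \<theta>_bilinear[unfolded trilinear_map_iff[OF vector_space_axioms vector_space_axioms
    V.vector_space_axioms V.vector_space_axioms], rule_format]

lemma rho_additive: "additive (\<rho> x)" "additive (\<lambda>x. \<rho> x v)"
  by (simp_all add: additive_def rho_linear)

lemmas rho_simps = rho_linear
  rho_additive(1)[THEN additive.diff] rho_additive(2)[THEN additive.diff]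
  rho_additive(1)[THEN additive.minus] rho_additive(2)[THEN additive.minus]
  rho_additive(1)[THEN additive.zero] rho_additive(2)[THEN additive.zero]

lemma theta_additive: "additive (\<theta> x y)"
  by (simp add: additive_def theta_linear)

lemmas theta_simps = theta_linear
  theta_additive[THEN additive.diff] theta_additive[THEN additive.minus]

lemma D_linear:
  "D x y (v + v') = D x y v + D x y v'"
  "D x y (sV c v) = sV c (D x y v)"
  "D x (y + y') v = D x y v + D x y' v"
  "D x (sL c y) v = sV c (D x y v)"
  "D (x + x') y v = D x y v + D x' y v"
  "D (sL c x) y v = sV c (D x y v)"
  by (simp_all add: rep_D_def rho_linear theta_linear br_linear algebra_simps
      V.scale_right_distrib V.scale_right_diff_distrib)

lemma D_additive: "additive (D x y)"
  by (simp add: additive_def D_linear)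

lemmas D_simps = D_linear D_additive[THEN additive.diff] D_additive[THEN additive.minus]

lemma D_skew: "D x y v = - D y x v"
  by (subst (1 2) rep_D_def, subst br_skew) (simp add: rho_simps algebra_simps)

lemma theta_br_left: "\<theta> (br x y) z v = \<theta> x z (\<rho> y v) - \<theta> y z (\<rho> x v)"
  using rep1[of x y z v] by (simp add: algebra_simps)

lemma theta_br_right: "\<theta> x (br y z) v = \<rho> y (\<theta> x z v) - \<rho> z (\<theta> x y v)"
  using rep3[of x y z v] by (simp add: algebra_simps)

lemma D_rho: "D x y (\<rho> z v) = \<rho> z (D x y v) + \<rho> (tr x y z) v"
  using rep2[of x y z v] by (simp add: algebra_simps)

lemma D_theta: "D a b (\<theta> x y v) = \<theta> x y (D a b v) + \<theta> (tr a b x) y v + \<theta> x (tr a b y) v"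
  using rep4[of a b x y v] by (simp add: algebra_simps)

lemma theta_tr_right: "\<theta> a (tr x y z) v = \<theta> y z (\<theta> a x v) - \<theta> x z (\<theta> a y v) + D x y (\<theta> a z v)"
  using rep5[of a x y z v] by (simp add: algebra_simps)

text \<open>Counterpart of \<open>LY2\<close> for the operators \<open>D\<close>. Expanding
  \<open>D\<close> and moving brackets out of \<open>\<theta>\<close> by \<open>rep1\<close> and
  \<open>rep3\<close> leaves the commutators of \<open>\<rho> x\<close> with \<open>D y z\<close>
  and their cyclic images, minus \<open>\<rho>\<close> of the Jacobi sum. By \<open>rep2\<close>
  these commutators are values of \<open>- \<rho>\<close> on triple brackets, so \<open>LY1\<close>
  finishes.\<close>

lemma D_br_cyclic: "D (br x y) z v + D (br y z) x v + D (br z x) y v = 0"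
proof -
  have "D (br x y) z v + D (br y z) x v + D (br z x) y v =
      (\<rho> x (D y z v) - D y z (\<rho> x v)) + (\<rho> y (D z x v) - D z x (\<rho> y v))
      + (\<rho> z (D x y v) - D x y (\<rho> z v)) - \<rho> (br (br x y) z + br (br y z) x + br (br z x) y) v"
    by (simp add: rep_D_def theta_br_left theta_br_right rho_simps algebra_simps)
  also have "\<dots> = - \<rho> (br (br x y) z + br (br y z) x + br (br z x) y
      + tr x y z + tr z x y + tr y z x) v"
    by (simp add: D_rho rho_simps algebra_simps)
  also have "\<dots> = 0"
    by (simp add: LY1 rho_simps)
  finally show ?thesis .
qed

text \<open>Each summand of \<open>D x y\<close> is built from \<open>\<rho>\<close>,
  \<open>\<theta>\<close> and \<open>br\<close>, and \<open>D a b\<close> acts on these as a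
  derivation: by \<open>rep2\<close>, \<open>rep4\<close> and \<open>LY3\<close>
  respectively.\<close>

lemma D_D: "D a b (D x y v) = D x y (D a b v) + D (tr a b x) y v + D x (tr a b y) v"
proof -
  have "D a b (D x y v) = D a b (\<theta> y x v) - D a b (\<theta> x y v) - D a b (\<rho> (br x y) v)
      + D a b (\<rho> x (\<rho> y v)) - D a b (\<rho> y (\<rho> x v))"
    by (subst (2) rep_D_def) (simp add: D_simps)
  also have "\<dots> = D x y (D a b v) + D (tr a b x) y v + D x (tr a b y) v"
    unfolding D_rho D_theta LY3
    \<comment> \<open>Only the three operators on the right are unfolded; \<open>D a b v\<close>
      stays an atomic vector, so the two sides match term by term.\<close>
    by (subst (6 7 8) rep_D_def) (simp add: rho_simps D_rho algebra_simps)
  finally show ?thesis .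
qed

end

section \<open>The twisted semidirect product on L x V\<close>

context ly_cocycle
begin

definition semidirect_br :: "'l \<times> 'v \<Rightarrow> 'l \<times> 'v \<Rightarrow> 'l \<times> 'v"
  where "semidirect_br X Y = (br (fst X) (fst Y),
    \<rho> (fst X) (snd Y) - \<rho> (fst Y) (snd X) + \<Gamma>1 (fst X) (fst Y))"

definition semidirect_tr :: "'l \<times> 'v \<Rightarrow> 'l \<times> 'v \<Rightarrow> 'l \<times> 'v \<Rightarrow> 'l \<times> 'v"
  where "semidirect_tr X Y Z = (tr (fst X) (fst Y) (fst Z),
    D (fst X) (fst Y) (snd Z) + \<theta> (fst Y) (fst Z) (snd X) - \<theta> (fst X) (fst Z) (snd Y)
    + \<Gamma>2 (fst X) (fst Y) (fst Z))"

lemmas Gamma1_linear =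
  \<Gamma>1_bilinear[unfolded bilinear_map_iff[OF vector_space_axioms vector_space_axioms
    V.vector_space_axioms], rule_format]

lemmas Gamma2_linear =
  \<Gamma>2_trilinear[unfolded trilinear_map_iff[OF vector_space_axioms vector_space_axioms
    vector_space_axioms V.vector_space_axioms], rule_format]

sublocale semidirect: lie_yamaguti_algebra prod.scale semidirect_br semidirect_tr
proof
  show "bilinear_map prod.scale prod.scale prod.scale semidirect_br"
    unfolding bilinear_map_iff[OF prod.p.vector_space_axioms prod.p.vector_space_axioms
        prod.p.vector_space_axioms]
    by (simp add: semidirect_br_def prod.scale_def rho_linear br_linear Gamma1_linear
        V.scale_right_distrib V.scale_right_diff_distrib)
  show "trilinear_map prod.scale prod.scale prod.scale prod.scale semidirect_tr"
    unfolding trilinear_map_iff[OF prod.p.vector_space_axioms prod.p.vector_space_axioms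
        prod.p.vector_space_axioms prod.p.vector_space_axioms]
    by (simp add: semidirect_tr_def prod.scale_def theta_linear D_linear tr_linear Gamma2_linear
        V.scale_right_distrib V.scale_right_diff_distrib)
next
  fix X Y Z A B :: "'l \<times> 'v"
  obtain x u where X: "X = (x, u)" by fastforce
  obtain y v where Y: "Y = (y, v)" by fastforce
  obtain z w where Z: "Z = (z, w)" by fastforce
  obtain a p where A: "A = (a, p)" by fastforce
  obtain b q where B: "B = (b, q)" by fastforce
  note semidirect = X Y Z A B semidirect_br_def semidirect_tr_def
  show "semidirect_br X Y = - semidirect_br Y X"
    using br_skew[of x y] \<Gamma>1_skew[of x y] by (simp add: semidirect)
  show "semidirect_tr X Y Z = - semidirect_tr Y X Z"
    using tr_skew[of x y z] \<Gamma>2_skew[of x y z] D_skew[of x y w] by (simp add: semidirect)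
  show "semidirect_br (semidirect_br X Y) Z + semidirect_br (semidirect_br Y Z) X
      + semidirect_br (semidirect_br Z X) Y
      + semidirect_tr X Y Z + semidirect_tr Z X Y + semidirect_tr Y Z X = 0"
    \<comment> \<open>The terms in \<open>u\<close>, \<open>v\<close>, \<open>w\<close> cancel by
      the definition of \<open>D\<close> alone: it is exactly the operator that this identity
      forces.\<close>
    using LY1[of x y z] cocycle1[of x y z]
    by (simp add: semidirect rep_D_def rho_simps zero_prod_def algebra_simps)
  show "semidirect_tr (semidirect_br X Y) Z A + semidirect_tr (semidirect_br Y Z) X A
      + semidirect_tr (semidirect_br Z X) Y A = 0"
    \<comment> \<open>The terms in \<open>u\<close>, \<open>v\<close>, \<open>w\<close> cancel by
      \<open>rep1\<close>, and those in \<open>p\<close> form the cyclic sum of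
      \<open>D_br_cyclic\<close>.\<close>
    using LY2[of x y z a] cocycle2[of x a y z] D_br_cyclic[of x y z p]
    by (simp add: semidirect theta_br_left theta_simps zero_prod_def algebra_simps)
  show "semidirect_tr A B (semidirect_br X Y) =
      semidirect_br (semidirect_tr A B X) Y + semidirect_br X (semidirect_tr A B Y)"
    \<comment> \<open>The terms in \<open>u\<close> and \<open>v\<close> are matched by
      \<open>rep2\<close>, those in \<open>p\<close> and \<open>q\<close> by
      \<open>rep3\<close>.\<close>
    using LY3[of a b x y] cocycle3[of x a b y]
    by (simp add: semidirect theta_br_right D_rho D_simps rho_simps algebra_simps)
  show "semidirect_tr A B (semidirect_tr X Y Z) =
      semidirect_tr (semidirect_tr A B X) Y Z + semidirect_tr X (semidirect_tr A B Y) Z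
      + semidirect_tr X Y (semidirect_tr A B Z)"
    (* instantiated because D_D, and D_theta together with theta_tr_right, loop as rewrite rules *)
    using LY4[of a b x y z] cocycle4[of y z a b x]
    by (simp add: semidirect theta_tr_right[of a x y z] theta_tr_right[of b x y z] D_theta[of a b]
        D_D[of a b x y] D_simps theta_simps algebra_simps)
qed

end

section \<open>Graph embeddings and transfer to the indexed operations\<close>

context twisted_rota_baxter_family
begin

definition graph :: "'o \<Rightarrow> 'v \<Rightarrow> 'l \<times> 'v"
  where "graph \<alpha> u = (T \<alpha> u, u)"

text \<open>Phrased through the product on L x V so that its identities can be projected by
  \<open>snd\<close>; unfolding recovers the explicit formula in \<open>\<rho>\<close> and
  \<open>\<Gamma>1\<close>.\<close>

definition family_br :: "'o \<Rightarrow> 'o \<Rightarrow> 'v \<Rightarrow> 'v \<Rightarrow> 'v"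
  where "family_br \<alpha> \<beta> u v = snd (semidirect_br (graph \<alpha> u) (graph \<beta> v))"

definition family_tr :: "'o \<Rightarrow> 'o \<Rightarrow> 'o \<Rightarrow> 'v \<Rightarrow> 'v \<Rightarrow> 'v \<Rightarrow> 'v"
  where "family_tr \<alpha> \<beta> \<gamma> u v w = snd (semidirect_tr (graph \<alpha> u) (graph \<beta> v) (graph \<gamma> w))"

text \<open>The V-components agree by construction, and equality of the L-components is
  \<open>T_br\<close>.\<close>

lemma graph_br: "graph (\<alpha> * \<beta>) (family_br \<alpha> \<beta> u v) = semidirect_br (graph \<alpha> u) (graph \<beta> v)"
  by (simp add: graph_def family_br_def semidirect_br_def T_br)

lemma graph_tr:
  "graph (\<alpha> * \<beta> * \<gamma>) (family_tr \<alpha> \<beta> \<gamma> u v w) =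
    semidirect_tr (graph \<alpha> u) (graph \<beta> v) (graph \<gamma> w)"
  by (simp add: graph_def family_tr_def semidirect_tr_def T_tr algebra_simps)

lemma T_simps: "T \<alpha> (u + v) = T \<alpha> u + T \<alpha> v" "T \<alpha> (sV c u) = sL c (T \<alpha> u)"
  using T_linear[of \<alpha>] by (simp_all add: Vector_Spaces.linear_iff)

lemma omega_lie_yamaguti_algebra: "omega_lie_yamaguti_algebra sV family_br family_tr"
proof
  fix \<alpha> \<beta> \<gamma> \<sigma> \<tau> :: 'o and x y z a b :: 'v
  show "bilinear_map sV sV sV (family_br \<alpha> \<beta>)"
    unfolding bilinear_map_iff[OF V.vector_space_axioms V.vector_space_axioms
        V.vector_space_axioms]
    by (simp add: family_br_def graph_def semidirect_br_def T_simps rho_linear Gamma1_linear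
        V.scale_right_distrib V.scale_right_diff_distrib)
  show "trilinear_map sV sV sV sV (family_tr \<alpha> \<beta> \<gamma>)"
    unfolding trilinear_map_iff[OF V.vector_space_axioms V.vector_space_axioms
        V.vector_space_axioms V.vector_space_axioms]
    by (simp add: family_tr_def graph_def semidirect_tr_def T_simps theta_linear D_linear
        Gamma2_linear V.scale_right_distrib V.scale_right_diff_distrib)
  show "family_br \<alpha> \<beta> x y = - family_br \<beta> \<alpha> y x"
    by (metis family_br_def semidirect.br_skew snd_uminus)
  show "family_tr \<alpha> \<beta> \<gamma> x y z = - family_tr \<beta> \<alpha> \<gamma> y x z"
    by (metis family_tr_def semidirect.tr_skew snd_uminus)
  show "family_br (\<alpha> * \<beta>) \<gamma> (family_br \<alpha> \<beta> x y) z + family_br (\<beta> * \<gamma>) \<alpha> (family_br \<beta> \<gamma> y z) x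
      + family_br (\<gamma> * \<alpha>) \<beta> (family_br \<gamma> \<alpha> z x) y
      + family_tr \<alpha> \<beta> \<gamma> x y z + family_tr \<beta> \<gamma> \<alpha> y z x + family_tr \<gamma> \<alpha> \<beta> z x y = 0"
    using arg_cong[OF semidirect.LY1[of "graph \<alpha> x" "graph \<beta> y" "graph \<gamma> z"], of snd]
    \<comment> \<open>A product index marks an outer bracket. Unfolding only those keeps the inner
      brackets under \<open>graph\<close>, where \<open>graph_br\<close> turns them into brackets of
      L x V.\<close>
    unfolding family_br_def[of "_ * _"] family_tr_def graph_br by (simp add: algebra_simps)
  show "family_tr (\<alpha> * \<beta>) \<gamma> \<sigma> (family_br \<alpha> \<beta> x y) z a
      + family_tr (\<beta> * \<gamma>) \<alpha> \<sigma> (family_br \<beta> \<gamma> y z) x a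
      + family_tr (\<gamma> * \<alpha>) \<beta> \<sigma> (family_br \<gamma> \<alpha> z x) y a = 0"
    using arg_cong[OF semidirect.LY2[of "graph \<alpha> x" "graph \<beta> y" "graph \<gamma> z" "graph \<sigma> a"], of snd]
    unfolding family_tr_def graph_br by simp
  show "family_tr \<sigma> \<alpha> (\<beta> * \<gamma>) a x (family_br \<beta> \<gamma> y z) =
      family_br (\<sigma> * \<alpha> * \<beta>) \<gamma> (family_tr \<sigma> \<alpha> \<beta> a x y) z
      + family_br \<beta> (\<sigma> * \<alpha> * \<gamma>) y (family_tr \<sigma> \<alpha> \<gamma> a x z)"
    \<comment> \<open>The same selection of outer operations, with the product index now in any of
      the positions that occur.\<close>
    unfolding family_br_def[of "_ * _"] family_br_def[of _ "_ * _"] family_tr_def[of _ _ "_ * _"]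
      graph_br graph_tr semidirect.LY3 by simp
  show "family_tr \<sigma> \<tau> (\<alpha> * \<beta> * \<gamma>) a b (family_tr \<alpha> \<beta> \<gamma> x y z) =
      family_tr (\<sigma> * \<tau> * \<alpha>) \<beta> \<gamma> (family_tr \<sigma> \<tau> \<alpha> a b x) y z
      + family_tr \<alpha> (\<sigma> * \<tau> * \<beta>) \<gamma> x (family_tr \<sigma> \<tau> \<beta> a b y) z
      + family_tr \<alpha> \<beta> (\<sigma> * \<tau> * \<gamma>) x y (family_tr \<sigma> \<tau> \<gamma> a b z)"
    \<comment> \<open>Fixing the first argument of \<open>semidirect.LY4\<close> to
      \<open>graph \<sigma> a\<close> stops it from rewriting the last summand of its own right
      side, which is again a nested triple bracket.\<close>
    unfolding family_tr_def[of _ _ "_ * _"] family_tr_def[of _ "_ * _"] family_tr_def[of "_ * _"]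
      graph_tr semidirect.LY4[of "graph \<sigma> a"] by simp
qed

end

theorem corollary5p4:
  fixes sL :: "'k::alg_closed_field \<Rightarrow> 'l::ab_group_add \<Rightarrow> 'l"
    and br :: "'l \<Rightarrow> 'l \<Rightarrow> 'l"
    and tr :: "'l \<Rightarrow> 'l \<Rightarrow> 'l \<Rightarrow> 'l"
    and sV :: "'k \<Rightarrow> 'v::ab_group_add \<Rightarrow> 'v"
    and \<rho> :: "'l \<Rightarrow> 'v \<Rightarrow> 'v"
    and \<theta> :: "'l \<Rightarrow> 'l \<Rightarrow> 'v \<Rightarrow> 'v"
    and \<Gamma>1 :: "'l \<Rightarrow> 'l \<Rightarrow> 'v"
    and \<Gamma>2 :: "'l \<Rightarrow> 'l \<Rightarrow> 'l \<Rightarrow> 'v"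
    and T :: "'o::ab_semigroup_mult \<Rightarrow> 'v \<Rightarrow> 'l"
  assumes "CHAR('k) \<noteq> 2" and "CHAR('k) \<noteq> 3"
    and "lie_yamaguti_algebra sL br tr"
    and "ly_representation sL br tr sV \<rho> \<theta>"
    and "ly_cocycle sL br tr sV \<rho> \<theta> \<Gamma>1 \<Gamma>2"
    and "twisted_rota_baxter_family sL br tr sV \<rho> \<theta> \<Gamma>1 \<Gamma>2 T"
  shows "omega_lie_yamaguti_algebra sV
    (\<lambda>\<alpha> \<beta> u v. \<rho> (T \<alpha> u) v - \<rho> (T \<beta> v) u + \<Gamma>1 (T \<alpha> u) (T \<beta> v))
    (\<lambda>\<alpha> \<beta> \<gamma> u v w.
      rep_D br \<rho> \<theta> (T \<alpha> u) (T \<beta> v) w + \<theta> (T \<beta> v) (T \<gamma> w) u - \<theta> (T \<alpha> u) (T \<gamma> w) v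
      + \<Gamma>2 (T \<alpha> u) (T \<beta> v) (T \<gamma> w))"
proof -
  interpret twisted_rota_baxter_family sL br tr sV \<rho> \<theta> \<Gamma>1 \<Gamma>2 T
    by fact
  show ?thesis
    using omega_lie_yamaguti_algebra
    by (simp add: family_br_def[abs_def] family_tr_def[abs_def] graph_def semidirect_br_def
        semidirect_tr_def)
qed

end
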